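(* Given vectors $\tilde{\mathbf Q}_{ij}^{kl}\in\mathbb R^{N_v^3}$ for $i\in\mathcal S$, $(j,k,l)\in\mathcal C_i^{\rm in}$, consider the constrained optimization problem for inelastic collisions $$\mathcal P^{\rm in}:\quad \min_{(\mathbf Q_{ij}^{kl})}\ \sum_{i\in\mathcal S}\ \sum_{(j,k,l)\in\mathcal C_i^{\rm in}}\left|\tilde{\mathbf Q}_{ij}^{kl}-\mathbf Q_{ij}^{kl}\right|^2\quad\text{subject to}\quad\sum_{i\in\mathcal S}\ \sum_{(j,k,l)\in\mathcal C_i^{\rm in}}\mathbf C_i^{\rm in}\,\mathbf Q_{ij}^{kl}=\mathbf 0\in\mathbb R^{5},$$ over vectors $\mathbf Q_{ij}^{kl}\in\mathbb R^{N_v^3}$. The solution of $\mathcal P^{\rm in}$ is $$\mathbf Q_{ij}^{kl}=\tilde{\mathbf Q}_{ij}^{kl}-(\mathbf C_i^{\rm in})^{\mathrm T}\,\mathbf A^{-1}\,\mathbf b,\qquad i\in\mathcal S,\ (j,k,l)\in\mathcal C_i^{\rm in},$$ where $$\mathbf A=N^{\rm in}\sum_{i\in\mathcal S}\mathbf C_i^{\rm in}(\mathbf C_i^{\rm in})^{\mathrm T},\qquad \mathbf b=\sum_{i\in\mathcal S}\ \sum_{(j,k,l)\in\mathcal C_i^{\rm in}}\mathbf C_i^{\rm in}\,\tilde{\mathbf Q}_{ij}^{kl}.$$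
   Context: $\mathcal S=\{1,\dots,N_s\}$ indexes species (internal energy levels); species $i$ has mass $m_i>0$ and internal energy $E_i$. The inelastic collision set is $\mathcal C_i^{\rm in}=\mathcal S^3\setminus\{(s,i,s): s\in\mathcal S\}$; a triple $(j,k,l)\in\mathcal C_i^{\rm in}$ stands for the collision $i+j\to k+l$. $N^{\rm in}$ is the cardinality of $\mathcal C_i^{\rm in}$, namely $N^{\rm in}=N_s^3-N_s$, which is independent of $i$. The velocity space is discretized by $N_v^3$ nodes $\mathbf v_{\mathbf k}=-L_v(1,1,1)+\mathbf k\,\Delta v$, $\mathbf k=(k_x,k_y,k_z)\in\{0,\dots,N_v-1\}^3$, with $L_v>0$ and $\Delta v=2L_v/N_v$. Each node has a global integration weight $w_{\mathbf k}=w_{k_x}w_{k_y}w_{k_z}$. A vector in $\mathbb R^{N_v^3}$ has components indexed by the nodes $\mathbf k$ (it stores the node values of a partial collision operator; the tilde denotes values that need not satisfy conservation). $|\cdot|$ is the Euclidean norm. The inelastic integration matrix $\mathbf C_i^{\rm in}$ is the real $5\times N_v^3$ matrix whose column associated with node $\mathbf k$ is $$(\mathbf C_i^{\rm in})_{\mathbf k}=(\Delta v)^3\,w_{\mathbf k}\left[\,m_i,\ m_i\mathbf v_{\mathbf k},\ \tfrac12 m_i|\mathbf v_{\mathbf k}|^2+E_i\,\right]^{\mathrm T}.$$ The matrix $\mathbf A$ appearing in the claim is assumed invertible. *)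

theory Defs
  imports "HOL-Analysis.Analysis"
begin

text \<open>
  The species set is a finite type \<open>'s\<close> with \<open>N\<^sub>s = CARD('s)\<close>. The one-dimensional node
  indices \<open>0, ..., N\<^sub>v - 1\<close> are the elements, in increasing order, of a finite linearly ordered
  type \<open>'n\<close> with \<open>N\<^sub>v = CARD('n)\<close>. A node of the velocity grid is \<open>k :: 'n^3\<close>, so that vectors in
  \<open>real^('n^3)\<close> have \<open>N\<^sub>v\<^sup>3\<close> components indexed by the nodes.
\<close>

definition grid_index :: "'n::{finite,linorder} \<Rightarrow> nat" where
  "grid_index a = card {..<a}"

lemma grid_index_strict_mono: "strict_mono (grid_index :: 'n::{finite,linorder} \<Rightarrow> nat)"
  unfolding strict_mono_def grid_index_def
  by (intro allI impI psubset_card_mono) auto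

lemma bij_betw_grid_index:
  "bij_betw (grid_index :: 'n::{finite,linorder} \<Rightarrow> nat) UNIV {..<CARD('n)}"
proof -
  have inj: "inj (grid_index :: 'n \<Rightarrow> nat)"
    using grid_index_strict_mono by (rule strict_mono_imp_inj_on)
  have "range (grid_index :: 'n \<Rightarrow> nat) \<subseteq> {..<CARD('n)}"
    unfolding grid_index_def by (auto intro!: psubset_card_mono)
  moreover have "card (range (grid_index :: 'n \<Rightarrow> nat)) = card {..<CARD('n)}"
    using inj by (simp add: card_image)
  ultimately have "range (grid_index :: 'n \<Rightarrow> nat) = {..<CARD('n)}"
    by (intro card_subset_eq) auto
  with inj show ?thesis by (simp add: bij_betw_def)
qed

definition mesh_size :: "'n::finite itself \<Rightarrow> real \<Rightarrow> real" where
  "mesh_size _ L = 2 * L / real CARD('n)"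

definition node_velocity :: "real \<Rightarrow> ('n::{finite,linorder})^3 \<Rightarrow> real^3" where
  "node_velocity L k = (\<chi> d. - L + real (grid_index (k $ d)) * mesh_size TYPE('n) L)"

definition node_weight :: "('n::finite \<Rightarrow> real) \<Rightarrow> 'n^3 \<Rightarrow> real" where
  "node_weight w k = w (k $ 1) * w (k $ 2) * w (k $ 3)"

definition inelastic_column ::
  "real \<Rightarrow> ('n::{finite,linorder} \<Rightarrow> real) \<Rightarrow> ('s \<Rightarrow> real) \<Rightarrow> ('s \<Rightarrow> real) \<Rightarrow> 's \<Rightarrow> 'n^3 \<Rightarrow> real^5" where
  "inelastic_column L w m E i k =
     ((mesh_size TYPE('n) L) ^ 3 * node_weight w k) *\<^sub>R
       (let v = node_velocity L k in
        vector [m i, m i * v $ 1, m i * v $ 2, m i * v $ 3, 1 / 2 * m i * (norm v)\<^sup>2 + E i])"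

definition inelastic_matrix ::
  "real \<Rightarrow> ('n::{finite,linorder} \<Rightarrow> real) \<Rightarrow> ('s \<Rightarrow> real) \<Rightarrow> ('s \<Rightarrow> real) \<Rightarrow> 's \<Rightarrow> real^('n^3)^5" where
  "inelastic_matrix L w m E i = (\<chi> r k. inelastic_column L w m E i k $ r)"

lemma column_inelastic_matrix: "column k (inelastic_matrix L w m E i) = inelastic_column L w m E i k"
  by (simp add: column_def inelastic_matrix_def vec_eq_iff)

definition inelastic_collisions :: "'s \<Rightarrow> ('s \<times> 's \<times> 's) set" where
  "inelastic_collisions i = UNIV - {(s, i, s) | s. True}"

definition num_inelastic :: "'s::finite itself \<Rightarrow> nat" where
  "num_inelastic _ = CARD('s) ^ 3 - CARD('s)"

lemma card_inelastic_collisions: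
  "card (inelastic_collisions (i::'s::finite)) = num_inelastic TYPE('s)"
proof -
  have "{(s::'s, i, s) | s. True} = range (\<lambda>s::'s. (s, i, s))" by auto
  moreover have "card (range (\<lambda>s::'s. (s, i, s))) = CARD('s)"
    by (rule card_image) (auto simp: inj_on_def)
  ultimately show ?thesis
    by (simp add: inelastic_collisions_def num_inelastic_def card_Diff_subset power3_eq_cube)
qed

text \<open>
  A family of vectors \<open>Q\<^sub>i\<^sub>j\<^sup>k\<^sup>l\<close> is a function \<open>Q\<close> with \<open>Q i (j, k, l)\<close> the member at \<open>i, j, k, l\<close>.
  Only the values with \<open>(j, k, l) \<in> inelastic_collisions i\<close> belong to the family; those at other
  arguments are irrelevant.
\<close>

type_synonym ('s, 'k) family = "'s \<Rightarrow> 's \<times> 's \<times> 's \<Rightarrow> real^'k"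

definition inelastic_moments ::
  "('s::finite \<Rightarrow> real^'k^5) \<Rightarrow> ('s, 'k::finite) family \<Rightarrow> real^5" where
  "inelastic_moments C Q = (\<Sum>i\<in>UNIV. \<Sum>c\<in>inelastic_collisions i. C i *v Q i c)"

definition inelastic_objective :: "('s::finite, 'k::finite) family \<Rightarrow> ('s, 'k) family \<Rightarrow> real" where
  "inelastic_objective Qt Q =
     (\<Sum>i\<in>UNIV. \<Sum>c\<in>inelastic_collisions i. (norm (Qt i c - Q i c))\<^sup>2)"

definition solves_inelastic_problem ::
  "('s::finite \<Rightarrow> real^'k^5) \<Rightarrow> ('s, 'k::finite) family \<Rightarrow> ('s, 'k) family \<Rightarrow> bool" where
  "solves_inelastic_problem C Qt Q \<longleftrightarrow>
     is_arg_min (inelastic_objective Qt) (\<lambda>Q. inelastic_moments C Q = 0) Q"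

definition inelastic_gram :: "('s::finite \<Rightarrow> real^'k::finite^5) \<Rightarrow> real^5^5" where
  "inelastic_gram C = real (num_inelastic TYPE('s)) *\<^sub>R (\<Sum>i\<in>UNIV. C i ** transpose (C i))"

end

theory Submission
  imports Defs
begin

text \<open>
  The corrections \<open>C\<^sub>i\<^sup>T x\<close> are orthogonal, in the product space of all families, to every
  family whose moments vanish. Hence the candidate is the orthogonal projection of the given family
  onto the feasible subspace, and Pythagoras' theorem gives both minimality and uniqueness.
\<close>

text \<open>Stationarity of the Lagrangian forces this shape, with \<open>x\<close> half the
  multiplier of the moment constraint. Keeping \<open>x\<close> free separates the orthogonality
  argument from the inversion of the Gram matrix.\<close>

definition corrected_family ::
  "('s \<Rightarrow> real^'k^5) \<Rightarrow> real^5 \<Rightarrow> ('s, 'k::finite) family \<Rightarrow> ('s, 'k) family" where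
  "corrected_family C x Q = (\<lambda>i c. Q i c - transpose (C i) *v x)"

lemma matrix_inv_right:
  assumes "invertible M"
  shows "M ** matrix_inv M = mat 1"
  using assms unfolding invertible_def matrix_inv_def by (rule someI2_ex) simp

lemma inelastic_moments_diff:
  "inelastic_moments C (\<lambda>i c. P i c - Q i c) = inelastic_moments C P - inelastic_moments C Q"
  by (simp add: inelastic_moments_def matrix_vector_mult_diff_distrib sum_subtractf)

text \<open>The summand is constant in the collision, so each inner sum yields a factor
  \<open>card (inelastic_collisions i)\<close>. This number is the same for all \<open>i\<close>,
  hence it comes out as one scalar.\<close>

lemma inelastic_moments_transpose:
  fixes C :: "'s::finite \<Rightarrow> real^'k::finite^5"
  shows "inelastic_moments C (\<lambda>i c. transpose (C i) *v x) = inelastic_gram C *v x"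
proof -
  have sum_mv: "(\<Sum>i\<in>I. M i *v x) = (\<Sum>i\<in>I. M i) *v x" if "finite I"
    for I :: "'s set" and M :: "'s \<Rightarrow> real^5^5"
    using that by induction (simp_all add: matrix_vector_mult_add_rdistrib)
  have "inelastic_moments C (\<lambda>i c. transpose (C i) *v x)
      = (\<Sum>i\<in>UNIV. real (num_inelastic TYPE('s)) *\<^sub>R ((C i ** transpose (C i)) *v x))"
    unfolding inelastic_moments_def matrix_vector_mul_assoc sum_constant_scaleR
      card_inelastic_collisions ..
  also have "\<dots> = inelastic_gram C *v x"
    by (simp add: inelastic_gram_def sum_mv scaleR_matrix_vector_assoc flip: scaleR_sum_right)
  finally show ?thesis .
qed

lemma inelastic_moments_corrected:
  assumes "invertible (inelastic_gram C)"
  shows "inelastic_moments C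
    (corrected_family C (matrix_inv (inelastic_gram C) *v inelastic_moments C Qt) Qt) = 0"
  unfolding corrected_family_def inelastic_moments_diff inelastic_moments_transpose
  using assms by (simp add: matrix_vector_mul_assoc matrix_inv_right)

text \<open>Adjointness moves each \<open>C i\<close> across the inner product. The form
  \<open>x v* C i\<close> is what simp makes of \<open>transpose (C i) *v x\<close>.\<close>

lemma sum_inner_vector_matrix_eq_moments:
  "(\<Sum>i\<in>UNIV. \<Sum>c\<in>inelastic_collisions i. (x v* C i) \<bullet> Q i c)
    = x \<bullet> inelastic_moments C Q"
  by (simp add: inelastic_moments_def inner_sum_right dot_lmul_matrix)

text \<open>Summed over all collisions, the cross terms give twice the inner product of
  \<open>x\<close> with the difference of the two moments, which is zero.\<close>

lemma inelastic_objective_pythagoras: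
  assumes "inelastic_moments C (corrected_family C x Qt) = inelastic_moments C Q"
  shows "inelastic_objective Qt Q =
    inelastic_objective Qt (corrected_family C x Qt)
      + inelastic_objective (corrected_family C x Qt) Q"
proof -
  define P where "P = corrected_family C x Qt"
  have "(norm (Qt i c - Q i c))\<^sup>2 = (norm (Qt i c - P i c))\<^sup>2 + (norm (P i c - Q i c))\<^sup>2
      + 2 * ((transpose (C i) *v x) \<bullet> (P i c - Q i c))" for i c
  proof -
    have "Qt i c - Q i c = (Qt i c - P i c) + (P i c - Q i c)"
      by simp
    then have "(norm (Qt i c - Q i c))\<^sup>2 = (norm (Qt i c - P i c))\<^sup>2
        + (norm (P i c - Q i c))\<^sup>2 + 2 * ((Qt i c - P i c) \<bullet> (P i c - Q i c))"
      using dot_norm[of "Qt i c - P i c" "P i c - Q i c"] by simp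
    then show ?thesis
      by (simp add: P_def corrected_family_def)
  qed
  then have "inelastic_objective Qt Q = inelastic_objective Qt P + inelastic_objective P Q
      + 2 * (x \<bullet> inelastic_moments C (\<lambda>i c. P i c - Q i c))"
    by (simp add: inelastic_objective_def sum.distrib sum_inner_vector_matrix_eq_moments
        flip: sum_distrib_left)
  with assms show ?thesis
    by (simp add: inelastic_moments_diff P_def)
qed

lemma inelastic_objective_nonneg: "0 \<le> inelastic_objective Qt Q"
  by (simp add: inelastic_objective_def sum_nonneg)

lemma inelastic_objective_eq_0_iff:
  "inelastic_objective P Q = 0 \<longleftrightarrow> (\<forall>i. \<forall>c\<in>inelastic_collisions i. Q i c = P i c)"
  by (auto simp: inelastic_objective_def sum_nonneg_eq_0_iff sum_nonneg)

text \<open>Families are total functions, so agreement on the collision sets is not equality;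
  feasibility has to be transferred explicitly.\<close>

lemma inelastic_moments_cong:
  assumes "\<And>i c. c \<in> inelastic_collisions i \<Longrightarrow> Q i c = P i c"
  shows "inelastic_moments C Q = inelastic_moments C P"
  using assms by (simp add: inelastic_moments_def)

lemma solves_inelastic_problem_iff:
  assumes feasible: "inelastic_moments C (corrected_family C x Qt) = 0"
  shows "solves_inelastic_problem C Qt Q \<longleftrightarrow>
    (\<forall>i. \<forall>c\<in>inelastic_collisions i. Q i c = corrected_family C x Qt i c)"
proof -
  define P where "P = corrected_family C x Qt"
  have feasible_P: "inelastic_moments C P = 0"
    using feasible by (simp add: P_def)
  have split: "inelastic_objective Qt R = inelastic_objective Qt P + inelastic_objective P R"
    if "inelastic_moments C R = 0" for R
    unfolding P_def by (rule inelastic_objective_pythagoras) (simp add: feasible that)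
  have "solves_inelastic_problem C Qt Q \<longleftrightarrow>
      inelastic_moments C Q = 0 \<and> inelastic_objective P Q = 0"
  proof
    assume "solves_inelastic_problem C Qt Q"
    \<comment> \<open>Minimality is tested against the competitor \<open>P\<close>; with
      \<open>split\<close> it forces the nonnegative excess \<open>inelastic_objective P Q\<close>
      to vanish.\<close>
    then have Q: "inelastic_moments C Q = 0"
      and "\<not> inelastic_objective Qt P < inelastic_objective Qt Q"
      using feasible_P by (auto simp: solves_inelastic_problem_def is_arg_min_def)
    with split[OF Q] inelastic_objective_nonneg[of P Q]
    show "inelastic_moments C Q = 0 \<and> inelastic_objective P Q = 0"
      by simp
  next
    assume "inelastic_moments C Q = 0 \<and> inelastic_objective P Q = 0"
    then show "solves_inelastic_problem C Qt Q"
      by (auto simp: solves_inelastic_problem_def is_arg_min_def split not_less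
          inelastic_objective_nonneg)
  qed
  \<comment> \<open>The feasibility conjunct is absorbed: a family agreeing with \<open>P\<close> on
    the collision sets inherits its zero moments.\<close>
  also have "\<dots> \<longleftrightarrow> (\<forall>i. \<forall>c\<in>inelastic_collisions i. Q i c = P i c)"
    using inelastic_moments_cong[of Q P C] feasible_P
    by (auto simp: inelastic_objective_eq_0_iff)
  finally show ?thesis
    by (simp add: P_def)
qed

text \<open>The equivalence gives existence of a minimizer and its uniqueness on the collision
  sets.\<close>

theorem proposition4p2:
  fixes L :: real
    and w :: "'n::{finite,linorder} \<Rightarrow> real"
    and m E :: "'s::finite \<Rightarrow> real"
    and Qt Q :: "('s, 'n^3) family"
    and C :: "'s \<Rightarrow> real^('n^3)^5"
    and A :: "real^5^5"
    and b :: "real^5"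
  assumes "L > 0"
    and "\<And>i. m i > 0"
    and "C = inelastic_matrix L w m E"
    and "A = inelastic_gram C"
    and "b = inelastic_moments C Qt"
    and "invertible A"
  shows "solves_inelastic_problem C Qt Q \<longleftrightarrow>
    (\<forall>i. \<forall>(j, k, l) \<in> inelastic_collisions i.
       Q i (j, k, l) = Qt i (j, k, l) - transpose (C i) *v (matrix_inv A *v b))"
proof -
  \<comment> \<open>Correcting by \<open>x\<close> lowers the moments from \<open>b\<close> to
    \<open>b - A *v x\<close>, so this \<open>x\<close> restores feasibility.\<close>
  have "inelastic_moments C (corrected_family C (matrix_inv A *v b) Qt) = 0"
    using assms(4-6) by (simp add: inelastic_moments_corrected)
  then show ?thesis
    by (auto simp: solves_inelastic_problem_iff corrected_family_def)
qed

end
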